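(* Every state operator on an effect algebra $E$ with an ordering set of states induces a state on $E$.
   Context: An effect algebra is $(E;0,1,\oplus)$ with a partial binary operation $\oplus$ that is commutative and associative (in the partial sense), such that for each $e$ there is a unique $e^\perp$ with $e\oplus e^\perp=1$, and $e\oplus 1$ is defined only if $e=0$. Write $a\perp b$ if $a\oplus b$ is defined, and $a\le b$ if $a\oplus c=b$ for some $c$. A state on $E$ is a map $s:E\to[0,1]\subseteq\mathbb R$ with $s(1)=1$ and $s(a\oplus b)=s(a)+s(b)$ whenever $a\perp b$. A set $\Omega$ of states on $E$ is ordering if for all $e,f\in E$: $\omega(e)\le\omega(f)$ for all $\omega\in\Omega$ implies $e\le f$. A state operator on $E$ is a map $\tau:E\to E$ with $\tau(1)=1$; $\tau(e\oplus f)=\tau(e)\oplus\tau(f)$ whenever $e\oplus f$ is defined; and $\tau(\tau(a))=\tau(a)$ for all $a\in E$.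
   Formalization: The formal statement assumes 0 ≠ 1 in E; this excludes only the one-element effect algebra, which has no state although the empty set of states on it is vacuously ordering, so the claim fails there. *)

theory Defs
  imports Complex_Main "HOL-Algebra.Congruence"
begin

text \<open>The partial sum is an option-valued operation: \<open>oplus E a b = None\<close> means that
  \<open>a \<oplus> b\<close> is undefined. Everything is relativised to \<open>carrier E\<close>.\<close>

record 'a effect_structure = "'a partial_object" +
  ezero :: 'a
  eone :: 'a
  oplus :: "'a \<Rightarrow> 'a \<Rightarrow> 'a option"

locale effect_algebra =
  fixes E (structure)
  assumes zero_closed: "ezero E \<in> carrier E"
    and one_closed: "eone E \<in> carrier E"
    and oplus_closed:
      "\<lbrakk>a \<in> carrier E; b \<in> carrier E; oplus E a b = Some c\<rbrakk> \<Longrightarrow> c \<in> carrier E"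
    and oplus_comm:
      "\<lbrakk>a \<in> carrier E; b \<in> carrier E\<rbrakk> \<Longrightarrow> oplus E a b = oplus E b a"
    and oplus_assoc:
      "\<lbrakk>a \<in> carrier E; b \<in> carrier E; c \<in> carrier E; oplus E a b = Some d; oplus E d c = Some e\<rbrakk>
        \<Longrightarrow> \<exists>f. oplus E b c = Some f \<and> oplus E a f = Some e"
    and orthosupplement:
      "e \<in> carrier E \<Longrightarrow> \<exists>!e'. e' \<in> carrier E \<and> oplus E e e' = Some (eone E)"
    and zero_one_law:
      "\<lbrakk>e \<in> carrier E; oplus E e (eone E) \<noteq> None\<rbrakk> \<Longrightarrow> e = ezero E"

definition effect_le :: "('a, 'm) effect_structure_scheme \<Rightarrow> 'a \<Rightarrow> 'a \<Rightarrow> bool" where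
  "effect_le E a b \<longleftrightarrow> (\<exists>c\<in>carrier E. oplus E a c = Some b)"

definition state :: "('a, 'm) effect_structure_scheme \<Rightarrow> ('a \<Rightarrow> real) \<Rightarrow> bool" where
  "state E s \<longleftrightarrow>
     s \<in> carrier E \<rightarrow> {0..1} \<and>
     s (eone E) = 1 \<and>
     (\<forall>a\<in>carrier E. \<forall>b\<in>carrier E. \<forall>c. oplus E a b = Some c \<longrightarrow> s c = s a + s b)"

definition ordering_set_of_states ::
  "('a, 'm) effect_structure_scheme \<Rightarrow> ('a \<Rightarrow> real) set \<Rightarrow> bool" where
  "ordering_set_of_states E \<Omega> \<longleftrightarrow>
     (\<forall>\<omega>\<in>\<Omega>. state E \<omega>) \<and>
     (\<forall>e\<in>carrier E. \<forall>f\<in>carrier E. (\<forall>\<omega>\<in>\<Omega>. \<omega> e \<le> \<omega> f) \<longrightarrow> effect_le E e f)"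

definition state_operator :: "('a, 'm) effect_structure_scheme \<Rightarrow> ('a \<Rightarrow> 'a) \<Rightarrow> bool" where
  "state_operator E \<tau> \<longleftrightarrow>
     \<tau> \<in> carrier E \<rightarrow> carrier E \<and>
     \<tau> (eone E) = eone E \<and>
     (\<forall>a\<in>carrier E. \<forall>b\<in>carrier E. \<forall>c. oplus E a b = Some c \<longrightarrow>
        oplus E (\<tau> a) (\<tau> b) = Some (\<tau> c)) \<and>
     (\<forall>a\<in>carrier E. \<tau> (\<tau> a) = \<tau> a)"

end

theory Submission
  imports Defs
begin

text \<open>A state pulls back along \<tau>: since \<tau> preserves 1 and defined sums, \<omega>
  \<circ> \<tau> is again a state (\<open>state_comp_state_operator\<close>). It remains to find
  some \<omega>. Over an empty \<Omega> the ordering condition is vacuous and would give 1 \<le> 0,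
  which collapses the algebra (\<open>ordering_set_of_states_nonempty\<close>).\<close>

lemma (in effect_algebra) one_le_imp_eq_one:
  assumes "a \<in> carrier E" and "effect_le E (eone E) a"
  shows "a = eone E"
proof -
  have eq_zero: "b = ezero E"
    if "b \<in> carrier E" and "oplus E (eone E) b = Some d" for b d
    using that oplus_comm[OF one_closed, of b] zero_one_law[of b] by simp
  \<comment> \<open>Neutrality of 0 is not an axiom. The orthosupplement of 1 must be 0, which
    yields 1 \<oplus> 0 = 1; the witness of 1 \<le> a is also 0, so a is the same sum.\<close>
  obtain b where b: "b \<in> carrier E" "oplus E (eone E) b = Some (eone E)"
    using orthosupplement[OF one_closed] by blast
  obtain c where c: "c \<in> carrier E" "oplus E (eone E) c = Some a"
    using assms(2) unfolding effect_le_def by blast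
  show ?thesis
    using b c eq_zero[OF b] eq_zero[OF c] by simp
qed

lemma (in effect_algebra) ordering_set_of_states_nonempty:
  assumes "ordering_set_of_states E \<Omega>" and "ezero E \<noteq> eone E"
  shows "\<Omega> \<noteq> {}"
proof
  assume "\<Omega> = {}"
  then have "effect_le E (eone E) (ezero E)"
    using assms(1) zero_closed one_closed unfolding ordering_set_of_states_def by blast
  then show False
    using one_le_imp_eq_one[OF zero_closed] assms(2) by blast
qed

lemma state_comp_state_operator:
  assumes "state E \<omega>" and "state_operator E \<tau>"
  shows "state E (\<omega> \<circ> \<tau>)"
proof -
  have closed: "\<tau> a \<in> carrier E" if "a \<in> carrier E" for a
    using assms(2) that unfolding state_operator_def by blast
  \<comment> \<open>\<tau> sends a defined sum to a defined sum inside the carrier, so additivity of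
    \<omega> applies to the images.\<close>
  have "\<omega> (\<tau> c) = \<omega> (\<tau> a) + \<omega> (\<tau> b)"
    if "a \<in> carrier E" "b \<in> carrier E" "oplus E a b = Some c" for a b c
    using assms that closed unfolding state_def state_operator_def by blast
  then show ?thesis
    using assms closed unfolding state_def state_operator_def by (auto simp: Pi_iff)
qed

text \<open>Nonemptiness of \<Omega> turns the universal claim into actual existence of an induced
  state. The case 0 = 1 is excluded because a one-element algebra has no state: 1 \<oplus> 1 = 1
  would force s(1) = 0.\<close>

theorem theorem3p10:
  fixes E :: "('a, 'm) effect_structure_scheme"
    and \<Omega> :: "('a \<Rightarrow> real) set"
    and \<tau> :: "'a \<Rightarrow> 'a"
  assumes "effect_algebra E"
    and "ezero E \<noteq> eone E"
    and "ordering_set_of_states E \<Omega>"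
    and "state_operator E \<tau>"
  shows "\<Omega> \<noteq> {} \<and> (\<forall>\<omega>\<in>\<Omega>. state E (\<omega> \<circ> \<tau>))"
  using effect_algebra.ordering_set_of_states_nonempty[OF assms(1,3,2)]
    state_comp_state_operator[OF _ assms(4)] assms(3)
  unfolding ordering_set_of_states_def by blast

end
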